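(* Let $\Sigma$ be a finite alphabet and let $\mathcal S$ be a probabilistic source producing infinite words on $\Sigma$, with fundamental probabilities $\pi_w$ ($w\in\Sigma^\star$), Dirichlet series $\Lambda(s)=\sum_{w\in\Sigma^\star}\pi_w^s$ and entropy $h(\mathcal S)$. Assume that $\Lambda$ is tame at $s=1$, with a simple pole at $s=1$ whose residue equals $1/h(\mathcal S)$. Let $f$ be the sorting toll, $f(0)=f(1)=0$ and $f(k)=k\log k$ for $k\ge 2$. For a finite sequence $x=(x_1,\dots,x_n)$ of infinite words put $$R(x)=\sum_{w\in\Sigma^\star} f\big(N_w(x)\big),$$ where $N_w(x)$ is the number of words of $x$ which begin with the finite prefix $w$. Let $r(n)$ be the expectation of $R(x)$ when $x$ consists of $n$ words emitted independently by $\mathcal S$. Then $$ r(n)\sim \frac{1}{2\,h(\mathcal S)}\, n\log^2 n\qquad (n\to\infty).$$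
   Context: A source $\mathcal S$ on the finite alphabet $\Sigma$ is a probabilistic process producing infinite words over $\Sigma$; $\Sigma^\star$ is the set of finite words. The fundamental probability $\pi_w$ of $w\in\Sigma^\star$ is the probability that a word emitted by $\mathcal S$ begins with the prefix $w$. $h(\mathcal S)$ denotes the entropy of the source. The parameter $R$ is the additive trie parameter with toll $f$: equivalently $R(x)=0$ if $|x|\le 1$, and $R(x)=f(|x|)+\sum_{\sigma\in\Sigma}R(x_{\langle\sigma\rangle})$ if $|x|\ge 2$, where $x_{\langle\sigma\rangle}$ is the sequence of the words of $x$ beginning with $\sigma$, stripped of this initial symbol. Polynomial growth: a function $\varpi$ on an unbounded domain $\Omega\subset\mathbb C$ is of polynomial growth if there is $r$ with $|\varpi(s)|=O(|s|^r)$ as $s\to\infty$ in $\Omega$ (in a vertical strip: $O(|\Im s|^r)$). Tameness: a function $\varpi$, analytic and of polynomial growth on $\Re s>c$, is tame at $s=c$ if one of the following holds. (S-shape) There is $\delta>0$ such that on $\Re s>c-\delta$ the function $\varpi$ is meromorphic, has a sole pole (of order $\ge 1$) at $s=c$, and is of polynomial growth as $|\Im s|\to\infty$. (H-shape) There are $A,B,\rho>0$ such that on the region $\{\sigma+it:\ |t|\ge B,\ \sigma>c-A|t|^{-\rho}\}\cup\{\sigma+it:\ |t|\le B,\ \sigma>c-AB^{-\rho}\}$ the function $\varpi$ is meromorphic, has a sole pole (of order $\ge 1$) at $s=c$, and is of polynomial growth as $|\Im s|\to\infty$. (P-shape) There are $\delta>0$ and $t\neq0$ such that on $\Re s>c-\delta$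 the function $\varpi$ is meromorphic, has only a pole (of order $\ge1$) at $s=c$ and a family of simple poles at $s_k=c+2ki\pi t$, $k\in\mathbb Z\setminus\{0\}$, and is of polynomial growth as $|\Im s|\to\infty$, meaning: of polynomial growth on a family of horizontal lines $\Im s=t_k$ with $t_k\to\infty$ and on vertical lines $\Re s=c-\delta'$ with some $\delta'<\delta$. *)

theory Defs
  imports "HOL-Probability.Probability" "HOL-Complex_Analysis.Complex_Analysis"
begin

section \<open>Sources\<close>

text \<open>
  The alphabet is a finite type. A source is given by the law of the infinite word it emits,
  a probability measure on the space of streams with the product (cylinder) sigma-algebra.
\<close>

definition source :: "'a::finite stream measure \<Rightarrow> bool" where
  "source M \<longleftrightarrow> prob_space M \<and> sets M = sets (stream_space (count_space UNIV))"

definition begins_with :: "'a stream \<Rightarrow> 'a list \<Rightarrow> bool" where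
  "begins_with x w \<longleftrightarrow> stake (length w) x = w"

definition fund_prob :: "'a::finite stream measure \<Rightarrow> 'a list \<Rightarrow> real" where
  "fund_prob M w = measure M {x \<in> space M. begins_with x w}"

text \<open>
  \<^term>\<open>0 powr s = (0 :: complex)\<close> for every \<open>s\<close>, so words of probability zero contribute nothing.
\<close>

definition source_Lambda :: "'a::finite stream measure \<Rightarrow> complex \<Rightarrow> complex" where
  "source_Lambda M s = (\<Sum>\<^sub>\<infinity>w::'a list. complex_of_real (fund_prob M w) powr s)"

text \<open>
  The entropy is a limit that need not exist for an arbitrary source, hence a relation.
  The convention \<open>0 log 0 = 0\<close> is built into \<^const>\<open>ln\<close> and multiplication.
\<close>

definition has_entropy :: "'a::finite stream measure \<Rightarrow> real \<Rightarrow> bool" where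
  "has_entropy M h \<longleftrightarrow>
     (\<lambda>k. - (1 / real k) * (\<Sum>w\<in>{w::'a list. length w = k}. fund_prob M w * ln (fund_prob M w)))
       \<longlonglongrightarrow> h"


section \<open>Tameness\<close>

definition half_plane :: "real \<Rightarrow> complex set" where
  "half_plane c = {s. Re s > c}"

definition poly_growth_on :: "(complex \<Rightarrow> complex) \<Rightarrow> complex set \<Rightarrow> bool" where
  "poly_growth_on F D \<longleftrightarrow>
     (\<exists>r::real. (\<lambda>s. norm (F s)) \<in> O[inf at_infinity (principal D)](\<lambda>s. norm s powr r))"

definition poly_growth_Im_on :: "(complex \<Rightarrow> complex) \<Rightarrow> complex set \<Rightarrow> bool" where
  "poly_growth_Im_on F D \<longleftrightarrow>
     (\<exists>r::real. (\<lambda>s. norm (F s))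
        \<in> O[inf (filtercomap (\<lambda>s. \<bar>Im s\<bar>) at_top) (principal D)](\<lambda>s. norm s powr r))"

definition meromorphic_with_poles ::
    "(complex \<Rightarrow> complex) \<Rightarrow> complex set \<Rightarrow> complex set \<Rightarrow> bool" where
  "meromorphic_with_poles F D P \<longleftrightarrow>
     P \<subseteq> D \<and> F meromorphic_on D \<and> F analytic_on (D - P) \<and> (\<forall>z\<in>P. is_pole F z)"

definition S_shape :: "(complex \<Rightarrow> complex) \<Rightarrow> real \<Rightarrow> bool" where
  "S_shape F c \<longleftrightarrow> (\<exists>\<delta>>0.
     meromorphic_with_poles F (half_plane (c - \<delta>)) {of_real c} \<and>
     poly_growth_Im_on F (half_plane (c - \<delta>)))"

definition H_region :: "real \<Rightarrow> real \<Rightarrow> real \<Rightarrow> real \<Rightarrow> complex set" where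
  "H_region c A B \<rho> =
     {s. \<bar>Im s\<bar> \<ge> B \<and> Re s > c - A * \<bar>Im s\<bar> powr (-\<rho>)} \<union>
     {s. \<bar>Im s\<bar> \<le> B \<and> Re s > c - A * B powr (-\<rho>)}"

definition H_shape :: "(complex \<Rightarrow> complex) \<Rightarrow> real \<Rightarrow> bool" where
  "H_shape F c \<longleftrightarrow> (\<exists>A>0. \<exists>B>0. \<exists>\<rho>>0.
     meromorphic_with_poles F (H_region c A B \<rho>) {of_real c} \<and>
     poly_growth_Im_on F (H_region c A B \<rho>))"

definition P_pole :: "real \<Rightarrow> real \<Rightarrow> int \<Rightarrow> complex" where
  "P_pole c t k = Complex c (2 * of_int k * pi * t)"

definition P_shape :: "(complex \<Rightarrow> complex) \<Rightarrow> real \<Rightarrow> bool" where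
  "P_shape F c \<longleftrightarrow> (\<exists>\<delta>>0. \<exists>t. t \<noteq> 0 \<and>
     meromorphic_with_poles F (half_plane (c - \<delta>)) (range (P_pole c t)) \<and>
     (\<forall>k. k \<noteq> 0 \<longrightarrow> zorder F (P_pole c t k) = -1) \<and>
     (\<exists>\<tau>::nat \<Rightarrow> real. filterlim \<tau> at_top sequentially \<and>
        poly_growth_on F {s \<in> half_plane (c - \<delta>). Im s \<in> range \<tau>}) \<and>
     (\<exists>\<delta>'. 0 < \<delta>' \<and> \<delta>' < \<delta> \<and> poly_growth_on F {s. Re s = c - \<delta>'}))"

text \<open>
  Polynomial growth on the open half-plane \<open>Re s > c\<close> is required on each smaller half-plane
  \<open>Re s \<ge> c'\<close> with \<open>c' > c\<close>. A uniform bound up to the boundary line would contradict the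
  P-shape, where that line carries poles with arbitrarily large imaginary part; for the other
  two shapes it follows from this condition and the growth as \<open>|Im s|\<close> tends to infinity.
\<close>

definition tame :: "(complex \<Rightarrow> complex) \<Rightarrow> real \<Rightarrow> bool" where
  "tame F c \<longleftrightarrow>
     F analytic_on half_plane c \<and>
     (\<forall>c'>c. poly_growth_on F {s. Re s \<ge> c'}) \<and>
     (S_shape F c \<or> H_shape F c \<or> P_shape F c)"


section \<open>The additive trie parameter\<close>

definition sorting_toll :: "nat \<Rightarrow> real" where
  "sorting_toll k = (if k \<le> 1 then 0 else real k * ln (real k))"

definition prefix_count :: "nat \<Rightarrow> (nat \<Rightarrow> 'a stream) \<Rightarrow> 'a list \<Rightarrow> nat" where
  "prefix_count n x w = card {i. i < n \<and> begins_with (x i) w}"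

text \<open>
  The sum is infinite when two words of the sequence coincide, so it is taken in
  \<^typ>\<open>ennreal\<close>, where it exists unconditionally (the toll is nonnegative).
\<close>

definition trie_param ::
    "(nat \<Rightarrow> real) \<Rightarrow> nat \<Rightarrow> (nat \<Rightarrow> 'a::finite stream) \<Rightarrow> ennreal" where
  "trie_param f n x = (\<Sum>\<^sub>\<infinity>w::'a list. ennreal (f (prefix_count n x w)))"

definition mean_trie_param ::
    "(nat \<Rightarrow> real) \<Rightarrow> 'a::finite stream measure \<Rightarrow> nat \<Rightarrow> ennreal" where
  "mean_trie_param f M n =
     (\<integral>\<^sup>+ x. trie_param f n x \<partial>(\<Pi>\<^sub>M i\<in>{..<n}. M))"

end

theory Submission
  imports Defs "HOL-Real_Asymp.Real_Asymp"
begin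

text \<open>
  The number \<open>N\<close> of words with prefix \<open>w\<close> is binomial with parameters \<open>n\<close> and \<open>p = \<pi>\<^sub>w\<close>. Tangent-line
  bounds for \<open>x ln x\<close> and the first two moments of \<open>N\<close> give
  \<open>n p max(0, ln(n p)) \<le> E[N ln N] \<le> n p ln(1 + n p)\<close>. With \<open>T = ln n\<close>, the two bounds differ by at
  most \<open>e n p\<^bsup>1+1/T\<^esup>\<close>, whose sum over all words, \<open>e n \<Lambda>(1 + 1/T)\<close>, is \<open>O(n T)\<close> because the pole is
  simple. The lower bound is \<open>n T p y q(y)\<close> with \<open>y = p\<^bsup>1/T\<^esup>\<close> and the continuous function
  \<open>q(y) = max(0, 1 + ln y) / y\<close> on \<open>[0,1]\<close>. When \<open>q\<close> is the monomial \<open>y\<^bsup>k\<^esup>\<close>, the sum of \<open>p y q(y)\<close>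
  is \<open>\<Lambda>(1 + (k+1)/T) \<sim> T / (h (k+1))\<close>; by Weierstrass approximation (Karamata's argument) it is
  asymptotic to \<open>(T/h) \<integral>\<^sub>0\<^sup>1 q = T / (2h)\<close> for the actual \<open>q\<close>.
\<close>

section \<open>A Tauberian theorem for power sums\<close>

text \<open>Powers of a base in [0,1] decrease as the exponent grows. This carries convergence from
  one exponent near 1 to all larger ones.\<close>

lemma summable_on_powr_mono:
  fixes p :: "'b \<Rightarrow> real"
  assumes p: "\<And>w. 0 \<le> p w" "\<And>w. p w \<le> 1" and st: "s \<le> t"
    and s: "(\<lambda>w. p w powr s) summable_on UNIV"
  shows "(\<lambda>w. p w powr t) summable_on UNIV"
proof (rule summable_on_comparison_test[OF s])
  show "p w powr t \<le> p w powr s" for w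
    using p[of w] st by (cases "p w = 0") (auto intro: powr_mono')
qed auto

lemma has_sum_finite_sum:
  fixes f :: "'i \<Rightarrow> 'b \<Rightarrow> 'c::topological_comm_monoid_add"
  assumes "finite I" "\<And>i. i \<in> I \<Longrightarrow> (f i has_sum s i) A"
  shows "((\<lambda>x. \<Sum>i\<in>I. f i x) has_sum (\<Sum>i\<in>I. s i)) A"
  using assms by (induction I rule: finite_induct) (auto intro: has_sum_add)

text \<open>The analytic input in abstract form: a Dirichlet series of numbers in [0,1] that behaves
  like \<open>c / (s - 1)\<close> as the real variable s decreases to 1. For a source,
  \<open>c\<close> will be the residue 1/h.\<close>

locale power_sums =
  fixes p :: "'b \<Rightarrow> real" and c :: real
  assumes p0: "0 \<le> p w" and p1: "p w \<le> 1"
    and summ: "s > 1 \<Longrightarrow> (\<lambda>w. p w powr s) summable_on UNIV"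
    and lim: "((\<lambda>s. (s - 1) * (\<Sum>\<^sub>\<infinity>w. p w powr s)) \<longlongrightarrow> c) (at_right 1)"
begin

text \<open>Substitute s = 1 + k/T in \<open>lim\<close>; then s - 1 = k/T, and dividing by k gives
  the claim.\<close>

lemma lim_at_top:
  assumes "k > 0"
  shows "((\<lambda>T. (\<Sum>\<^sub>\<infinity>w. p w powr (1 + k / T)) / T) \<longlongrightarrow> c / k) at_top"
proof -
  have "filterlim (\<lambda>T. 1 + k / T) (at_right 1) at_top"
    using assms by real_asymp
  from filterlim_compose[OF lim this]
  have "((\<lambda>T. (k / T) * (\<Sum>\<^sub>\<infinity>w. p w powr (1 + k / T)) * (1 / k)) \<longlongrightarrow> c * (1 / k)) at_top"
    by (intro tendsto_mult_right) simp
  then show ?thesis using assms by simp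
qed

text \<open>The argument of \<open>g\<close> stays in [0,1], so the terms are dominated by
  \<open>B\<close> times those of the convergent series at exponent 1 + 1/T > 1.\<close>

lemma weighted_summable:
  assumes "T > 0" and B: "\<And>y. y \<in> {0..1} \<Longrightarrow> \<bar>g y\<bar> \<le> B"
  shows "(\<lambda>w. p w powr (1 + 1 / T) * g (p w powr (1 / T))) summable_on UNIV"
proof (rule iffD2[OF summable_on_iff_abs_summable_on_real], rule Infinite_Sum.abs_summable_on_comparison_test')
  show "(\<lambda>w. B * p w powr (1 + 1 / T)) summable_on UNIV"
    using \<open>T > 0\<close> by (intro summable_on_cmult_right summ) simp
  show "norm (p w powr (1 + 1 / T) * g (p w powr (1 / T))) \<le> B * p w powr (1 + 1 / T)" for w
  proof -
    have "\<bar>g (p w powr (1 / T))\<bar> \<le> B"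
      using p0[of w] p1[of w] \<open>T > 0\<close> by (intro B) (simp add: powr_le1)
    then have "p w powr (1 + 1 / T) * \<bar>g (p w powr (1 / T))\<bar> \<le> p w powr (1 + 1 / T) * B"
      by (intro mult_left_mono) simp_all
    then show ?thesis by (simp add: abs_mult mult.commute)
  qed
qed

text \<open>The weight already contributes one 1/T to the exponent, hence \<open>Suc i\<close>. Both
  sides vanish when the base is 0.\<close>

lemma powr_split:
  assumes "T > 0"
  shows "p w powr (1 + 1 / T) * (p w powr (1 / T)) ^ i = p w powr (1 + real (Suc i) / T)"
proof (cases "p w = 0")
  case False
  then have "p w > 0" using p0[of w] by simp
  then show ?thesis
    by (simp add: powr_powr powr_add[symmetric] add_divide_distrib add.assoc flip: powr_realpow)
qed auto

text \<open>The monomial y^i turns the weighted sum into the series at 1 + (i+1)/T, which is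
  asymptotic to c T / (i+1), and 1/(i+1) is the integral of y^i over [0,1]. Linearity does the
  rest.\<close>

lemma karamata_polynomial:
  "((\<lambda>T. (\<Sum>\<^sub>\<infinity>w. p w powr (1 + 1 / T) * (\<Sum>i\<le>n. a i * (p w powr (1 / T)) ^ i)) / T)
     \<longlongrightarrow> c * integral {0..1} (\<lambda>y. \<Sum>i\<le>n. a i * y ^ i)) at_top"
proof -
  have int: "integral {0..1} (\<lambda>y::real. \<Sum>i\<le>n. a i * y ^ i) = (\<Sum>i\<le>n. a i / real (Suc i))"
  proof -
    have "((\<lambda>y::real. \<Sum>i\<le>n. a i * y ^ i) has_integral (\<Sum>i\<le>n. a i * (1 / real (Suc i)))) {0..1}"
    proof (intro has_integral_sum has_integral_mult_right finite_atMost)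
      fix i
      have "((\<lambda>y::real. y ^ i) has_integral (1 ^ Suc i / real (Suc i) - 0 ^ Suc i / real (Suc i))) {0..1}"
        by (rule fundamental_theorem_of_calculus)
          (auto intro!: derivative_eq_intros simp: has_real_derivative_iff_has_vector_derivative[symmetric]
             simp del: power_Suc of_nat_Suc)
      then show "((\<lambda>y::real. y ^ i) has_integral (1 / real (Suc i))) {0..1}" by simp
    qed
    then show ?thesis by (simp add: integral_unique)
  qed
  have "((\<lambda>T. \<Sum>i\<le>n. a i * ((\<Sum>\<^sub>\<infinity>w. p w powr (1 + real (Suc i) / T)) / T))
      \<longlongrightarrow> (\<Sum>i\<le>n. a i * (c / real (Suc i)))) at_top"
    by (intro tendsto_sum tendsto_mult_left lim_at_top) simp
  also have "(\<Sum>i\<le>n. a i * (c / real (Suc i))) = c * integral {0..1} (\<lambda>y. \<Sum>i\<le>n. a i * y ^ i)"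
    unfolding int sum_distrib_left by (simp add: mult_ac)
  finally show ?thesis
  proof (rule Lim_transform_eventually)
    show "\<forall>\<^sub>F T in at_top. (\<Sum>i\<le>n. a i * ((\<Sum>\<^sub>\<infinity>w. p w powr (1 + real (Suc i) / T)) / T))
        = (\<Sum>\<^sub>\<infinity>w. p w powr (1 + 1 / T) * (\<Sum>i\<le>n. a i * (p w powr (1 / T)) ^ i)) / T"
      using eventually_gt_at_top[of 0]
    proof eventually_elim
      case (elim T)
      have "((\<lambda>w. p w powr (1 + real (Suc i) / T)) has_sum (\<Sum>\<^sub>\<infinity>w. p w powr (1 + real (Suc i) / T))) UNIV"
        for i using elim by (intro has_sum_infsum summ) (simp del: of_nat_Suc)
      then have "((\<lambda>w. \<Sum>i\<le>n. a i * p w powr (1 + real (Suc i) / T)) has_sum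
          (\<Sum>i\<le>n. a i * (\<Sum>\<^sub>\<infinity>w. p w powr (1 + real (Suc i) / T)))) UNIV"
        by (intro has_sum_finite_sum has_sum_cmult_right finite_atMost)
      moreover have "(\<Sum>i\<le>n. a i * p w powr (1 + real (Suc i) / T))
          = p w powr (1 + 1 / T) * (\<Sum>i\<le>n. a i * (p w powr (1 / T)) ^ i)" for w
        unfolding sum_distrib_left
        by (intro sum.cong refl) (simp add: mult.left_commute powr_split[OF elim] del: of_nat_Suc)
      ultimately show ?case
        by (simp add: infsumI sum_divide_distrib del: of_nat_Suc)
    qed
  qed
qed

lemma c_nonneg: "c \<ge> 0"
proof (rule tendsto_lowerbound[OF lim_at_top[of 1, simplified]])
  show "\<forall>\<^sub>F T in at_top. 0 \<le> (\<Sum>\<^sub>\<infinity>w. p w powr (1 + 1 / T)) / T"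
    using eventually_gt_at_top[of 0] by eventually_elim (auto intro!: divide_nonneg_pos infsum_nonneg)
qed auto

text \<open>Replace \<open>q\<close> by a polynomial uniformly close to it. Because the weights are
  nonnegative with total at most (c + 1) T eventually, a uniform error \<open>e\<close> changes the
  normalized sum by at most e (c + 1).\<close>

lemma karamata:
  assumes q: "continuous_on {0..1} q"
  shows "((\<lambda>T. (\<Sum>\<^sub>\<infinity>w. p w powr (1 + 1 / T) * q (p w powr (1 / T))) / T)
     \<longlongrightarrow> c * integral {0..1} q) at_top"
proof (rule tendstoI)
  fix \<epsilon> :: real
  assume "\<epsilon> > 0"
  \<comment> \<open>Three errors share epsilon: replacing \<open>q\<close> by \<open>g\<close> in
    the sum, the limit for \<open>g\<close>, and replacing \<open>g\<close> by \<open>q\<close> in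
    the integral. Using c + 1 leaves room above the limit \<open>c\<close> and keeps the denominator
    positive when c = 0.\<close>
  define e where "e = \<epsilon> / (3 * (c + 1))"
  have e: "e > 0" using \<open>\<epsilon> > 0\<close> c_nonneg by (simp add: e_def)
  obtain g where "real_polynomial_function g" and g: "\<And>y. y \<in> {0..1} \<Longrightarrow> \<bar>q y - g y\<bar> < e"
    using Stone_Weierstrass_real_polynomial_function[OF compact_Icc q e] by blast
  then obtain a n where g_eq: "g = (\<lambda>y. \<Sum>i\<le>n. a i * y ^ i)"
    by (auto simp: real_polynomial_function_iff_sum)
  have cont_g: "continuous_on {0..1} g" unfolding g_eq by (intro continuous_intros)
  define S where "S = (\<lambda>g T. (\<Sum>\<^sub>\<infinity>w. p w powr (1 + 1 / T) * g (p w powr (1 / T))) / T)"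
  have "\<bar>integral {0..1} g - integral {0..1} q\<bar> \<le> e"
  proof -
    have "norm (integral {0..1} (\<lambda>y. g y - q y)) \<le> e * (1 - 0)"
      using cont_g q g by (intro integral_bound) (auto intro!: continuous_intros less_imp_le simp: abs_minus_commute)
    also have "integral {0..1} (\<lambda>y. g y - q y) = integral {0..1} g - integral {0..1} q"
      using cont_g q by (intro integral_diff integrable_continuous_real)
    finally show ?thesis by simp
  qed
  from mult_left_mono[OF this c_nonneg]
  have int: "\<bar>c * integral {0..1} g - c * integral {0..1} q\<bar> \<le> c * e"
    using c_nonneg by (simp add: abs_mult flip: right_diff_distrib)
  have "\<forall>\<^sub>F T in at_top. dist (S g T) (c * integral {0..1} g) < \<epsilon> / 3"
    using tendstoD[OF karamata_polynomial, of "\<epsilon> / 3" a n] \<open>\<epsilon> > 0\<close> by (simp add: S_def g_eq)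
  moreover have "\<forall>\<^sub>F T in at_top. (\<Sum>\<^sub>\<infinity>w. p w powr (1 + 1 / T)) / T < c + 1"
    using order_tendstoD(2)[OF lim_at_top[of 1, simplified], of "c + 1"] by simp
  ultimately show "\<forall>\<^sub>F T in at_top. dist ((\<Sum>\<^sub>\<infinity>w. p w powr (1 + 1 / T) * q (p w powr (1 / T))) / T)
      (c * integral {0..1} q) < \<epsilon>"
    using eventually_gt_at_top[of 0]
  proof eventually_elim
    case (elim T)
    have bounded: "\<exists>B. \<forall>y\<in>{0..1}. \<bar>f y\<bar> \<le> B" if "continuous_on {0..1} f" for f :: "real \<Rightarrow> real"
      using compact_imp_bounded[OF compact_continuous_image[OF that compact_Icc]]
      by (auto simp: bounded_iff)
    have summable: "(\<lambda>w. p w powr (1 + 1 / T) * f (p w powr (1 / T))) summable_on UNIV"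
      if "continuous_on {0..1} f" for f
    proof -
      obtain B where "\<forall>y\<in>{0..1}. \<bar>f y\<bar> \<le> B" using bounded[OF \<open>continuous_on {0..1} f\<close>] ..
      then show ?thesis by (intro weighted_summable elim(3)) auto
    qed
    \<comment> \<open>One-sided comparison, stated for a general pair so that it can be applied to
      \<open>q\<close>, \<open>g\<close> in both orders.\<close>
    have 1: "(\<Sum>\<^sub>\<infinity>w. p w powr (1 + 1 / T) * f (p w powr (1 / T)))
        \<le> (\<Sum>\<^sub>\<infinity>w. p w powr (1 + 1 / T) * f' (p w powr (1 / T))) + e * (\<Sum>\<^sub>\<infinity>w. p w powr (1 + 1 / T))"
      if f: "continuous_on {0..1} f" "continuous_on {0..1} f'" "\<And>y. y \<in> {0..1} \<Longrightarrow> f y \<le> f' y + e" for f f'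
    proof -
      have s: "(\<lambda>w. e * p w powr (1 + 1 / T)) summable_on UNIV"
        using elim by (intro summable_on_cmult_right summ) auto
      have "(\<Sum>\<^sub>\<infinity>w. p w powr (1 + 1 / T) * f (p w powr (1 / T)))
        \<le> (\<Sum>\<^sub>\<infinity>w. p w powr (1 + 1 / T) * f' (p w powr (1 / T)) + e * p w powr (1 + 1 / T))"
      proof (intro infsum_mono summable summable_on_add s f)
        fix w
        have "f (p w powr (1 / T)) \<le> f' (p w powr (1 / T)) + e"
          using p0[of w] p1[of w] elim by (intro f) (auto intro: powr_le1)
        from mult_left_mono[OF this powr_ge_zero[of "p w" "1 + 1 / T"]]
        show "p w powr (1 + 1 / T) * f (p w powr (1 / T))
          \<le> p w powr (1 + 1 / T) * f' (p w powr (1 / T)) + e * p w powr (1 + 1 / T)"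
          by (simp add: algebra_simps)
      qed
      also have "\<dots> = (\<Sum>\<^sub>\<infinity>w. p w powr (1 + 1 / T) * f' (p w powr (1 / T))) + e * (\<Sum>\<^sub>\<infinity>w. p w powr (1 + 1 / T))"
        using s by (simp add: infsum_add summable f infsum_cmult_right')
      finally show ?thesis .
    qed
    have g_le: "q y \<le> g y + e" "g y \<le> q y + e" if "y \<in> {0..1}" for y
      using g[OF that] by linarith+
    have up: "S q T \<le> S g T + e * ((\<Sum>\<^sub>\<infinity>w. p w powr (1 + 1 / T)) / T)"
      using divide_right_mono[OF 1[OF q cont_g g_le(1)], of T] elim(3)
      by (simp add: S_def add_divide_distrib)
    have lo: "S g T \<le> S q T + e * ((\<Sum>\<^sub>\<infinity>w. p w powr (1 + 1 / T)) / T)"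
      using divide_right_mono[OF 1[OF cont_g q g_le(2)], of T] elim(3)
      by (simp add: S_def add_divide_distrib)
    have "e * ((\<Sum>\<^sub>\<infinity>w. p w powr (1 + 1 / T)) / T) \<le> e * (c + 1)"
      using elim e by (intro mult_left_mono) auto
    also have "\<dots> = \<epsilon> / 3" using c_nonneg by (simp add: e_def field_simps)
    finally have "\<bar>S q T - S g T\<bar> \<le> \<epsilon> / 3" using up lo by linarith
    moreover have "c * e < \<epsilon> / 3"
      using e c_nonneg \<open>e * (c + 1) = \<epsilon> / 3\<close> by (simp add: algebra_simps)
    moreover have "\<bar>S g T - c * integral {0..1} g\<bar> < \<epsilon> / 3" using elim by (simp add: dist_real_def)
    ultimately have "\<bar>S q T - c * integral {0..1} q\<bar> < \<epsilon>" using int by linarith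
    then show ?case by (simp add: S_def dist_real_def)
  qed
qed

end

section \<open>The mean toll of a binomial count\<close>

text \<open>Both sides equal the series along an enumeration of the type. The integral form makes
  Tonelli applicable to the sum over words.\<close>

lemma infsum_ennreal_eq_nn_integral:
  fixes f :: "'b::countable \<Rightarrow> ennreal"
  assumes "infinite (UNIV :: 'b set)"
  shows "(\<Sum>\<^sub>\<infinity>w. f w) = (\<integral>\<^sup>+w. f w \<partial>count_space UNIV)"
proof -
  let ?g = "from_nat_into (UNIV :: 'b set)"
  have bij: "bij_betw ?g UNIV UNIV"
    using assms by (intro bij_betw_from_nat_into) auto
  have "(\<integral>\<^sup>+w. f w \<partial>count_space UNIV) = (\<Sum>k. f (?g k))"
    using nn_integral_bij_count_space[OF bij, of f] by (simp add: nn_integral_count_space_nat)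
  also have "\<dots> = (\<Sum>\<^sub>\<infinity>k. f (?g k))"
    by (intro sums_unique[symmetric] has_sum_imp_sums has_sum_infsum nonneg_summable_on_complete) simp
  also have "\<dots> = (\<Sum>\<^sub>\<infinity>w. f w)"
    using bij by (rule infsum_reindex_bij_betw)
  finally show ?thesis ..
qed

text \<open>For nonnegative terms both sums are the supremum of the same finite partial
  sums.\<close>

lemma infsum_ennreal_real:
  fixes g :: "'b \<Rightarrow> real"
  assumes "g summable_on UNIV" "\<And>w. g w \<ge> 0"
  shows "(\<Sum>\<^sub>\<infinity>w. ennreal (g w)) = ennreal (\<Sum>\<^sub>\<infinity>w. g w)"
  using assms infsum_nonneg_is_SUPREMUM_ennreal[of g UNIV]
    nonneg_infsum_complete[of UNIV "\<lambda>w. ennreal (g w)"]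
  by (simp add: sum_ennreal)

text \<open>Multiply ln t <= t - 1 at t = m/x by x. At x = 0 the right-hand side is -m.\<close>

lemma xlnx_ge_tangent:
  fixes x m :: real
  assumes "x \<ge> 0" "m > 0"
  shows "x * ln x \<ge> m * ln m + (ln m + 1) * (x - m)"
proof (cases "x = 0")
  case False
  then have x: "x > 0" using assms by simp
  have "ln (m / x) \<le> m / x - 1" using x assms by (intro ln_le_minus_one) simp
  then have "x * (ln m - ln x) \<le> x * (m / x - 1)"
    using x assms by (intro mult_left_mono) (auto simp: ln_div)
  then show ?thesis using x by (simp add: algebra_simps)
qed (use assms in \<open>simp add: algebra_simps\<close>)

text \<open>Multiply ln t <= t - 1 at t = x/m by x. The bound involves only x and its square, so two
  moments control its mean, and \<open>m\<close> remains free to be optimized.\<close>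

lemma xlnx_le_square:
  fixes x m :: real
  assumes "x \<ge> 0" "m > 0"
  shows "x * ln x \<le> x * ln m + x\<^sup>2 / m - x"
proof (cases "x = 0")
  case False
  then have x: "x > 0" using assms by simp
  have "ln (x / m) \<le> x / m - 1" using x assms by (intro ln_le_minus_one) simp
  then have "x * (ln x - ln m) \<le> x * (x / m - 1)"
    using x assms by (intro mult_left_mono) (auto simp: ln_div)
  then show ?thesis using x by (simp add: algebra_simps power2_eq_square)
qed auto

text \<open>The case distinction disappears because the factor 0 kills the term at k = 0 and ln 1 =
  0.\<close>

lemma sorting_toll_eq: "sorting_toll k = real k * ln (real k)"
  by (cases k rule: nat.exhaust[of _ , case_names 0 Suc]) (auto simp: sorting_toll_def le_Suc_eq)

lemma sorting_toll_nonneg: "sorting_toll k \<ge> 0"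
  by (auto simp: sorting_toll_def)

section \<open>Prefix counts of independent words: moments and bounds\<close>

locale iid_source =
  fixes M :: "'a::finite stream measure"
  assumes source: "source M"
begin

sublocale prob_space M using source by (simp add: source_def)

sublocale iid: product_prob_space "\<lambda>_::nat. M" by unfold_locales

lemma sets_M [measurable_cong]: "sets M = sets (stream_space (count_space UNIV))"
  using source by (simp add: source_def)

lemma space_M [simp]: "space M = UNIV"
  using sets_eq_imp_space_eq[OF sets_M] by (simp add: space_stream_space)

definition starts :: "'a list \<Rightarrow> 'a stream \<Rightarrow> real" where
  "starts w x = indicator {x. begins_with x w} x"

lemma measurable_begins_with [measurable]: "Measurable.pred M (\<lambda>x. begins_with x w)"
  unfolding begins_with_def by measurable

lemma measurable_starts [measurable]: "starts w \<in> borel_measurable M"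
proof -
  have "starts w = (\<lambda>x. if begins_with x w then 1 else 0)"
    by (auto simp: starts_def fun_eq_iff indicator_def)
  then show ?thesis by simp
qed

lemma integrable_starts: "integrable M (starts w)"
  by (rule integrable_const_bound[of _ 1]) (auto simp: starts_def indicator_def)

lemma expectation_starts: "expectation (starts w) = fund_prob M w"
proof -
  have "{x. begins_with x w} \<in> sets M"
    using measurable_begins_with[of w] by (simp add: pred_def)
  then show ?thesis by (simp add: starts_def[abs_def] fund_prob_def)
qed

text \<open>Independence, after padding the product with constant factors 1 at the indices outside
  \<open>J\<close>.\<close>

lemma expectation_prod_starts:
  fixes n :: nat
  assumes "J \<subseteq> {..<n}"
  shows "(\<integral>x. (\<Prod>i\<in>J. starts w (x i)) \<partial>(\<Pi>\<^sub>M i\<in>{..<n}. M)) = fund_prob M w ^ card J"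
proof -
  define f where "f i = (if i \<in> J then starts w else (\<lambda>_. 1))" for i
  have "(\<integral>x. (\<Prod>i<n. f i (x i)) \<partial>(\<Pi>\<^sub>M i\<in>{..<n}. M)) = (\<Prod>i<n. expectation (f i))"
    by (rule iid.product_integral_prod) (auto simp: f_def integrable_starts)
  also have "(\<lambda>x. (\<Prod>i<n. f i (x i))) = (\<lambda>x. (\<Prod>i\<in>J. starts w (x i)))"
    by (intro ext prod.mono_neutral_cong_right) (use assms in \<open>auto simp: f_def\<close>)
  also have "(\<Prod>i<n. expectation (f i)) = (\<Prod>i\<in>J. fund_prob M w)"
    by (intro prod.mono_neutral_cong_right)
      (use assms prob_space in \<open>auto simp: f_def expectation_starts\<close>)
  finally show ?thesis by simp
qed

lemma prefix_count_eq_sum: "real (prefix_count n x w) = (\<Sum>i<n. starts w (x i))"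
proof -
  have "(\<Sum>i<n. starts w (x i)) = (\<Sum>i\<in>{i. i < n \<and> begins_with (x i) w}. 1)"
    unfolding starts_def by (intro sum.mono_neutral_cong_right) (auto simp: indicator_def)
  then show ?thesis by (simp add: prefix_count_def)
qed

lemma measurable_prefix_count [measurable]:
  "(\<lambda>x. real (prefix_count n x w)) \<in> borel_measurable (\<Pi>\<^sub>M i\<in>{..<n}. M)"
  unfolding prefix_count_eq_sum by measurable

lemma prefix_count_le: "prefix_count n x w \<le> n"
proof -
  have "card {i. i < n \<and> begins_with (x i) w} \<le> card {..<n}" by (intro card_mono) auto
  then show ?thesis by (simp add: prefix_count_def)
qed

text \<open>The count takes only the values 0, ..., n, so any function of it is bounded by the
  finite sum of the absolute values there.\<close>

lemma integrable_prefix_count: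
  fixes g :: "real \<Rightarrow> real"
  assumes [measurable]: "g \<in> borel_measurable borel"
  shows "integrable (\<Pi>\<^sub>M i\<in>{..<n}. M) (\<lambda>x. g (real (prefix_count n x w)))"
proof -
  interpret P: prob_space "\<Pi>\<^sub>M i\<in>{..<n}. M" by (rule prob_space_PiM) unfold_locales
  show ?thesis
  proof (rule P.integrable_const_bound[of _ "\<Sum>k\<le>n. \<bar>g (real k)\<bar>"], rule AE_I2)
    show "norm (g (real (prefix_count n x w))) \<le> (\<Sum>k\<le>n. \<bar>g (real k)\<bar>)" for x
      using prefix_count_le[of n x w]
      by (auto intro!: member_le_sum[of _ _ "\<lambda>k. \<bar>g (real k)\<bar>"])
  qed measurable
qed

definition mean :: "nat \<Rightarrow> 'a list \<Rightarrow> (real \<Rightarrow> real) \<Rightarrow> real" where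
  "mean n w g = (\<integral>x. g (real (prefix_count n x w)) \<partial>(\<Pi>\<^sub>M i\<in>{..<n}. M))"

lemma integrable_prod_starts:
  "integrable (\<Pi>\<^sub>M i\<in>{..<n}. M) (\<lambda>x. starts w (x i) * starts w (x j))" if "i < n" "j < n" for n :: nat
proof -
  interpret P: prob_space "\<Pi>\<^sub>M i\<in>{..<n}. M" by (rule prob_space_PiM) unfold_locales
  show ?thesis using that
    by (intro P.integrable_const_bound[of _ 1]) (auto simp: starts_def indicator_def[abs_def] abs_mult)
qed

lemma starts_square: "starts w x * starts w x = starts w x"
  by (auto simp: starts_def indicator_def)

text \<open>Expand the square of a sum of indicators: n diagonal terms with mean p and n (n - 1)
  off-diagonal terms with mean p^2.\<close>

lemma mean_square: "mean n w (\<lambda>x. x\<^sup>2) = real n * fund_prob M w + real n * (real n - 1) * (fund_prob M w)\<^sup>2"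
proof -
  let ?p = "fund_prob M w"
  \<comment> \<open>For i = j the set {i, j} is a singleton and the squared indicator is the
    indicator, so both cases follow from the product formula.\<close>
  have E: "(\<integral>x. starts w (x i) * starts w (x j) \<partial>(\<Pi>\<^sub>M i\<in>{..<n}. M)) = (if i = j then ?p else ?p\<^sup>2)"
    if "i < n" "j < n" for i j
    using expectation_prod_starts[of "{i, j}" n w] that by (auto simp: starts_square power2_eq_square)
  have "mean n w (\<lambda>x. x\<^sup>2) = (\<integral>x. (\<Sum>i<n. \<Sum>j<n. starts w (x i) * starts w (x j)) \<partial>(\<Pi>\<^sub>M i\<in>{..<n}. M))"
    by (simp add: mean_def prefix_count_eq_sum power2_eq_square sum_product)
  also have "\<dots> = (\<Sum>i<n. \<Sum>j<n. (if i = j then ?p else ?p\<^sup>2))"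
  proof -
    have "(\<integral>x. (\<Sum>i<n. \<Sum>j<n. starts w (x i) * starts w (x j)) \<partial>(\<Pi>\<^sub>M i\<in>{..<n}. M))
        = (\<Sum>i<n. \<integral>x. (\<Sum>j<n. starts w (x i) * starts w (x j)) \<partial>(\<Pi>\<^sub>M i\<in>{..<n}. M))"
      by (intro Bochner_Integration.integral_sum Bochner_Integration.integrable_sum integrable_prod_starts) auto
    also have "\<dots> = (\<Sum>i<n. \<Sum>j<n. \<integral>x. starts w (x i) * starts w (x j) \<partial>(\<Pi>\<^sub>M i\<in>{..<n}. M))"
      by (intro sum.cong refl Bochner_Integration.integral_sum integrable_prod_starts) auto
    also have "\<dots> = (\<Sum>i<n. \<Sum>j<n. (if i = j then ?p else ?p\<^sup>2))"
      by (intro sum.cong refl E) auto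
    finally show ?thesis .
  qed
  also have "\<dots> = (\<Sum>i<n. \<Sum>j<n. (?p\<^sup>2 + (if i = j then ?p - ?p\<^sup>2 else 0)))"
    by (intro sum.cong) auto
  also have "\<dots> = real n * ?p + real n * (real n - 1) * ?p\<^sup>2"
    by (simp add: sum.distrib algebra_simps power2_eq_square)
  finally show ?thesis .
qed

lemma mean_id: "mean n w (\<lambda>x. x) = real n * fund_prob M w"
proof -
  have "mean n w (\<lambda>x. x) = (\<integral>x. (\<Sum>i<n. starts w (x i) * starts w (x i)) \<partial>(\<Pi>\<^sub>M i\<in>{..<n}. M))"
    by (simp add: mean_def prefix_count_eq_sum starts_square)
  also have "\<dots> = (\<Sum>i<n. \<integral>x. starts w (x i) * starts w (x i) \<partial>(\<Pi>\<^sub>M i\<in>{..<n}. M))"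
    by (intro Bochner_Integration.integral_sum integrable_prod_starts) auto
  also have "\<dots> = (\<Sum>i<n. fund_prob M w)"
  proof (intro sum.cong refl)
    show "(\<integral>x. starts w (x i) * starts w (x i) \<partial>(\<Pi>\<^sub>M i\<in>{..<n}. M)) = fund_prob M w" if "i \<in> {..<n}" for i
      using expectation_prod_starts[of "{i}" n w] that by (simp add: starts_square)
  qed
  finally show ?thesis by simp
qed

lemma mean_mono:
  assumes "\<And>k. k \<le> n \<Longrightarrow> f (real k) \<le> g (real k)"
    and [measurable]: "f \<in> borel_measurable borel" "g \<in> borel_measurable borel"
  shows "mean n w f \<le> mean n w g"
  unfolding mean_def using assms prefix_count_le by (intro integral_mono integrable_prefix_count) auto

text \<open>Jensen's inequality for x ln x: take the tangent at the mean \<open>m\<close> of the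
  count, whose linear term has expectation 0.\<close>

lemma mean_xlnx_ge:
  assumes "n > 0" "fund_prob M w > 0"
  shows "mean n w (\<lambda>x. x * ln x) \<ge> real n * fund_prob M w * ln (real n * fund_prob M w)"
proof -
  define m where "m = real n * fund_prob M w"
  have "m > 0" using assms by (simp add: m_def)
  have "mean n w (\<lambda>x. m * ln m + (ln m + 1) * (x - m)) = m * ln m + (ln m + 1) * (mean n w (\<lambda>x. x) - m)"
  proof -
    interpret P: prob_space "\<Pi>\<^sub>M i\<in>{..<n}. M" by (rule prob_space_PiM) unfold_locales
    show ?thesis
      using integrable_prefix_count[of "\<lambda>x. x" n w] by (simp add: mean_def P.prob_space)
  qed
  also have "\<dots> = m * ln m" by (simp add: mean_id m_def)
  finally have "m * ln m = mean n w (\<lambda>x. m * ln m + (ln m + 1) * (x - m))" ..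
  also have "\<dots> \<le> mean n w (\<lambda>x. x * ln x)"
    using \<open>m > 0\<close> by (intro mean_mono xlnx_ge_tangent) auto
  finally show ?thesis by (simp add: m_def)
qed

lemma mean_xlnx_le:
  assumes "n > 0"
  shows "mean n w (\<lambda>x. x * ln x) \<le> real n * fund_prob M w * ln (1 + real n * fund_prob M w)"
proof -
  \<comment> \<open>This is the ratio of second to first moment when p > 0. With it, the mean of x^2
    / m cancels the mean of x, and only n p ln m is left.\<close>
  define m where "m = 1 + (real n - 1) * fund_prob M w"
  have p: "fund_prob M w \<ge> 0" by (simp add: fund_prob_def)
  have m: "m > 0" "m \<le> 1 + real n * fund_prob M w"
    unfolding m_def using assms p
    by (intro add_pos_nonneg add_left_mono mult_right_mono mult_nonneg_nonneg; simp)+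
  have "mean n w (\<lambda>x. x * ln x) \<le> mean n w (\<lambda>x. x * ln m + x\<^sup>2 / m - x)"
    using m by (intro mean_mono xlnx_le_square) auto
  also have "\<dots> = mean n w (\<lambda>x. x) * ln m + mean n w (\<lambda>x. x\<^sup>2) / m - mean n w (\<lambda>x. x)"
    using integrable_prefix_count[of "\<lambda>x. x" n w] integrable_prefix_count[of "\<lambda>x. x\<^sup>2" n w]
    by (simp add: mean_def)
  also have "mean n w (\<lambda>x. x\<^sup>2) = mean n w (\<lambda>x. x) * m"
    unfolding mean_square mean_id m_def by (simp add: algebra_simps power2_eq_square)
  also have "mean n w (\<lambda>x. x) * ln m + mean n w (\<lambda>x. x) * m / m - mean n w (\<lambda>x. x)
      = real n * fund_prob M w * ln m"
    using m by (simp add: mean_id)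
  also have "\<dots> \<le> real n * fund_prob M w * ln (1 + real n * fund_prob M w)"
    using m p by (intro mult_left_mono) auto
  finally show ?thesis .
qed

section \<open>The expectation as a sum over words\<close>

lemma mean_xlnx_nonneg: "mean n w (\<lambda>x. x * ln x) \<ge> 0"
  unfolding mean_def sorting_toll_eq[symmetric]
  by (intro Bochner_Integration.integral_nonneg sorting_toll_nonneg)

text \<open>Tonelli: the expectation and the sum over words commute since the toll is
  nonnegative.\<close>

lemma mean_trie_param_eq:
  "mean_trie_param sorting_toll M n = (\<Sum>\<^sub>\<infinity>w. ennreal (mean n w (\<lambda>x. x * ln x)))"
proof -
  have inf: "infinite (UNIV :: 'a list set)" by (rule infinite_UNIV_listI)
  have "mean_trie_param sorting_toll M n =
      (\<integral>\<^sup>+x. \<integral>\<^sup>+w. ennreal (real (prefix_count n x w) * ln (real (prefix_count n x w)))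
         \<partial>count_space UNIV \<partial>(\<Pi>\<^sub>M i\<in>{..<n}. M))"
    unfolding mean_trie_param_def trie_param_def infsum_ennreal_eq_nn_integral[OF inf] sorting_toll_eq ..
  also have "\<dots> = (\<integral>\<^sup>+w. \<integral>\<^sup>+x. ennreal (real (prefix_count n x w) * ln (real (prefix_count n x w)))
         \<partial>(\<Pi>\<^sub>M i\<in>{..<n}. M) \<partial>count_space UNIV)"
  proof (rule nn_integral_count_space_nn_integral)
    show "(\<lambda>x. ennreal (real (prefix_count n x w) * ln (real (prefix_count n x w))))
        \<in> borel_measurable (\<Pi>\<^sub>M i\<in>{..<n}. M)" for w
      by measurable
  qed simp
  also have "\<dots> = (\<integral>\<^sup>+w. ennreal (mean n w (\<lambda>x. x * ln x)) \<partial>count_space UNIV)"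
  proof (rule nn_integral_cong)
    show "(\<integral>\<^sup>+x. ennreal (real (prefix_count n x w) * ln (real (prefix_count n x w)))
         \<partial>(\<Pi>\<^sub>M i\<in>{..<n}. M)) = ennreal (mean n w (\<lambda>x. x * ln x))" for w
      unfolding mean_def
    proof (rule nn_integral_eq_integral)
      show "integrable (\<Pi>\<^sub>M i\<in>{..<n}. M) (\<lambda>x. real (prefix_count n x w) * ln (real (prefix_count n x w)))"
        by (rule integrable_prefix_count) measurable
      show "AE x in \<Pi>\<^sub>M i\<in>{..<n}. M. 0 \<le> real (prefix_count n x w) * ln (real (prefix_count n x w))"
        unfolding sorting_toll_eq[symmetric] by (simp add: sorting_toll_nonneg)
    qed
  qed
  also have "\<dots> = (\<Sum>\<^sub>\<infinity>w. ennreal (mean n w (\<lambda>x. x * ln x)))"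
    by (rule infsum_ennreal_eq_nn_integral[OF inf, symmetric])
  finally show ?thesis .
qed

end

section \<open>The mean trie parameter\<close>

text \<open>This is the function \<open>q\<close> above; capping the argument at \<open>1/e\<close> makes it continuous on the whole line.\<close>

definition log_weight :: "real \<Rightarrow> real" where
  "log_weight y = (1 + ln (max y (exp (-1)))) / max y (exp (-1))"

lemma continuous_log_weight: "continuous_on A log_weight"
proof -
  have "0 < max y (exp (-1))" for y :: real by (simp add: less_max_iff_disj)
  then show ?thesis
    unfolding log_weight_def by (intro continuous_intros) (metis less_irrefl)+
qed

text \<open>The weight vanishes on [0, 1/e], and on [1/e, 1] it is the derivative of (1 + ln y)^2 /
  2, which rises from 0 to 1/2. This 1/2 is the constant in the final asymptotics.\<close>

lemma integral_log_weight: "integral {0..1} log_weight = 1 / 2"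
proof -
  have "(log_weight has_integral 0) {0..exp (-1)}"
    by (rule has_integral_is_0) (auto simp: log_weight_def)
  moreover have "(log_weight has_integral ((1 + ln 1)\<^sup>2 / 2 - (1 + ln (exp (-1)))\<^sup>2 / 2)) {exp (-1)..1}"
  proof (rule fundamental_theorem_of_calculus)
    fix y :: real
    assume y: "y \<in> {exp (-1)..1}"
    then have "y > 0" using less_le_trans[OF exp_gt_zero[of "-1::real"], of y] by simp
    then have "((\<lambda>y. (1 + ln y)\<^sup>2 / 2) has_real_derivative (1 + ln y) / y) (at y within {exp (-1)..1})"
      by (auto intro!: derivative_eq_intros simp: field_simps)
    then show "((\<lambda>y. (1 + ln y)\<^sup>2 / 2) has_vector_derivative log_weight y) (at y within {exp (-1)..1})"
      using y by (simp add: has_real_derivative_iff_has_vector_derivative log_weight_def max_absorb1)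
  qed simp
  ultimately have "(log_weight has_integral (0 + ((1 + ln 1)\<^sup>2 / 2 - (1 + ln (exp (-1)))\<^sup>2 / 2))) {0..1}"
    by (intro has_integral_combine[where b = 1 and c = "exp (-1)"]) auto
  then show ?thesis by (simp add: integral_unique)
qed

text \<open>With y = p^(1/T), the product of y and its weight is max(0, 1 + ln y), and ln y = ln p /
  T.\<close>

lemma powr_log_weight:
  fixes p T :: real
  assumes "p > 0" "T > 0"
  shows "p powr (1 + 1 / T) * log_weight (p powr (1 / T)) = p * max 0 (1 + ln p / T)"
proof -
  have y: "p powr (1 / T) = exp (ln p / T)" using assms by (simp add: powr_def)
  have "exp (ln p / T) * log_weight (exp (ln p / T)) = max 0 (1 + ln p / T)"
  proof (cases "ln p / T \<ge> -1")
    case True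
    then show ?thesis by (simp add: log_weight_def max_absorb1 max_absorb2)
  next
    case False
    then show ?thesis by (simp add: log_weight_def max_absorb1 max_absorb2)
  qed
  then show ?thesis using assms by (simp add: powr_add y mult.assoc)
qed

text \<open>The excess of the left side over max(0, u) is at most exp(-|u|), hence at most exp(u/T).
  This shape is chosen for u = ln(n p) and T = ln n, where exp(u/T) becomes e p^(1/T), a term of the
  same Dirichlet type.\<close>

lemma ln_one_plus_exp_le:
  fixes u T :: real
  assumes "T \<ge> 1"
  shows "ln (1 + exp u) \<le> max 0 u + exp (u / T)"
proof (cases "u \<le> 0")
  case True
  have "ln (1 + exp u) \<le> exp u" by (rule ln_add_one_self_le_self) simp
  also have "u * T \<le> u * 1" using True assms by (intro mult_left_mono_neg) auto
  then have "exp u \<le> exp (u / T)" using assms by (simp add: le_divide_eq)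
  finally show ?thesis using True by simp
next
  case False
  have "1 + exp u = exp u * (1 + exp (- u))" by (simp add: exp_minus field_simps)
  moreover have "1 + exp (- u) > 0" by (simp add: add_pos_pos)
  ultimately have "ln (1 + exp u) = u + ln (1 + exp (- u))"
    using ln_mult_pos[of "exp u" "1 + exp (- u)"] by simp
  also have "ln (1 + exp (- u)) \<le> exp (- u)" by (rule ln_add_one_self_le_self) simp
  also have "- u \<le> u / T" using False assms by (intro order.trans[of "- u" 0 "u / T"]) auto
  then have "exp (- u) \<le> exp (u / T)" by simp
  finally show ?thesis using False by simp
qed

section \<open>Summation of the bounds over all words\<close>

context iid_source
begin

lemma fund_prob_bounds: "0 \<le> fund_prob M w" "fund_prob M w \<le> 1"
  by (simp_all add: fund_prob_def)

lemma mean_xlnx_lower: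
  assumes n: "ln (real n) \<ge> 1"
  shows "real n * ln (real n) * (fund_prob M w powr (1 + 1 / ln (real n)) *
           log_weight (fund_prob M w powr (1 / ln (real n)))) \<le> mean n w (\<lambda>x. x * ln x)"
proof (cases "fund_prob M w = 0")
  case False
  define p T where "p = fund_prob M w" and "T = ln (real n)"
  have p: "p > 0" using False fund_prob_bounds[of w] by (simp add: p_def)
  have T: "T \<ge> 1" and n: "n > 0" using n by (auto simp: T_def intro: Nat.gr0I)
  \<comment> \<open>Here T + ln p = ln(n p), since T = ln n.\<close>
  have "real n * T * (p * max 0 (1 + ln p / T)) = real n * p * max 0 (ln (real n * p))"
    using T p n by (simp add: max_def ln_mult field_simps flip: T_def)
  also have "\<dots> \<le> mean n w (\<lambda>x. x * ln x)"
    using mean_xlnx_ge[of n w] mean_xlnx_nonneg[of n w] n p by (simp add: max_def p_def)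
  finally show ?thesis
    unfolding p_def[symmetric] T_def[symmetric] using T p by (simp add: powr_log_weight)
qed (simp add: mean_xlnx_nonneg)

lemma mean_xlnx_upper:
  assumes n: "ln (real n) \<ge> 1"
  shows "mean n w (\<lambda>x. x * ln x) \<le>
     real n * ln (real n) * (fund_prob M w powr (1 + 1 / ln (real n)) *
       log_weight (fund_prob M w powr (1 / ln (real n))))
     + real n * exp 1 * fund_prob M w powr (1 + 1 / ln (real n))"
proof -
  define p T where "p = fund_prob M w" and "T = ln (real n)"
  have T: "T \<ge> 1" and n: "n > 0" using n by (auto simp: T_def intro: Nat.gr0I)
  have le: "mean n w (\<lambda>x. x * ln x) \<le> real n * p * ln (1 + real n * p)"
    using mean_xlnx_le[OF n, of w] by (simp add: p_def)
  show ?thesis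
  proof (cases "p = 0")
    case False
    then have p: "p > 0" using fund_prob_bounds[of w] by (simp add: p_def)
    define u where "u = T + ln p"
    have u: "real n * p = exp u" using p n by (simp add: u_def T_def exp_add)
    have "real n * p * ln (1 + real n * p) \<le> real n * p * (max 0 u + exp (u / T))"
      unfolding u using ln_one_plus_exp_le[OF T, of u] by (intro mult_left_mono) auto
    also have "\<dots> = real n * T * (p * max 0 (1 + ln p / T)) + real n * exp 1 * (p * p powr (1 / T))"
    proof -
      have "max 0 u = T * max 0 (1 + ln p / T)" using T by (simp add: u_def max_def field_simps)
      \<comment> \<open>The quotient u/T is 1 + ln p / T; its first summand produces the factor e of
        the error term.\<close>
      moreover have "exp (u / T) = exp 1 * p powr (1 / T)"
        using T p by (simp add: u_def powr_def add_divide_distrib exp_add)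
      ultimately show ?thesis by (simp only:) (simp add: algebra_simps)
    qed
    also have "p * max 0 (1 + ln p / T) = p powr (1 + 1 / T) * log_weight (p powr (1 / T))"
      using T p by (simp add: powr_log_weight)
    also have "p * p powr (1 / T) = p powr (1 + 1 / T)" using p by (simp add: powr_add)
    finally show ?thesis
      unfolding p_def[symmetric] T_def[symmetric] using le by linarith
  qed (use le in \<open>simp add: p_def\<close>)
qed

lemma mean_trie_param_limit:
  assumes "power_sums (fund_prob M) c"
  shows "(\<lambda>n. enn2real (mean_trie_param sorting_toll M n) / (real n * (ln (real n))\<^sup>2))
           \<longlonglongrightarrow> c / 2"
proof -
  interpret power_sums "fund_prob M" c by fact
  define A where "A T = (\<Sum>\<^sub>\<infinity>w. fund_prob M w powr (1 + 1 / T) * log_weight (fund_prob M w powr (1 / T)))" for T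
  define Z where "Z T = (\<Sum>\<^sub>\<infinity>w. fund_prob M w powr (1 + 1 / T))" for T
  define r where "r n = enn2real (mean_trie_param sorting_toll M n)" for n
  have ln_at_top: "filterlim (\<lambda>n. ln (real n)) at_top sequentially" by real_asymp
  \<comment> \<open>Sum the two bounds over all words and divide by n T^2. They differ by e (Z T /
    T) / T, which tends to 0 because Z T / T converges.\<close>
  have bounds: "A T / T \<le> r n / (real n * T\<^sup>2) \<and> r n / (real n * T\<^sup>2) \<le> A T / T + exp 1 * (Z T / T) * (1 / T)"
    if n: "ln (real n) \<ge> 1" and T_eq: "T = ln (real n)" for n T
  proof -
    have T: "T \<ge> 1" and "n > 0" using n by (auto simp: T_eq intro: Nat.gr0I)
    obtain B where "\<forall>y\<in>{0..1}. \<bar>log_weight y\<bar> \<le> B"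
      using compact_imp_bounded[OF compact_continuous_image[OF continuous_log_weight compact_Icc[of 0 1]]]
      by (auto simp: bounded_iff)
    then have sA: "(\<lambda>w. fund_prob M w powr (1 + 1 / T) * log_weight (fund_prob M w powr (1 / T))) summable_on UNIV"
      using T by (intro weighted_summable[where B = B]) auto
    have sZ: "(\<lambda>w. fund_prob M w powr (1 + 1 / T)) summable_on UNIV"
      using T by (intro summ) auto
    let ?lo = "\<lambda>w. real n * T * (fund_prob M w powr (1 + 1 / T) * log_weight (fund_prob M w powr (1 / T)))"
    let ?err = "\<lambda>w. real n * exp 1 * fund_prob M w powr (1 + 1 / T)"
    have lo: "(?lo has_sum (real n * T * A T)) UNIV"
      unfolding A_def by (intro has_sum_cmult_right has_sum_infsum sA)
    have "(?err has_sum (real n * exp 1 * Z T)) UNIV"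
      unfolding Z_def by (intro has_sum_cmult_right has_sum_infsum sZ)
    with lo have up: "((\<lambda>w. ?lo w + ?err w) has_sum (real n * T * A T + real n * exp 1 * Z T)) UNIV"
      by (rule has_sum_add)
    have le_up: "mean n w (\<lambda>x. x * ln x) \<le> ?lo w + ?err w" for w
      using mean_xlnx_upper[OF n, of w] by (simp add: T_eq)
    have sE: "(\<lambda>w. mean n w (\<lambda>x. x * ln x)) summable_on UNIV"
      by (rule summable_on_comparison_test[OF has_sum_imp_summable[OF up]])
        (use le_up mean_xlnx_nonneg in auto)
    \<comment> \<open>Summability makes the expectation finite, so \<open>enn2real\<close> returns
      the real sum; an infinite value would have become 0.\<close>
    have r: "r n = (\<Sum>\<^sub>\<infinity>w. mean n w (\<lambda>x. x * ln x))"
      unfolding r_def mean_trie_param_eq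
      by (simp add: infsum_ennreal_real[OF sE] mean_xlnx_nonneg infsum_nonneg)
    have "real n * T * A T \<le> r n"
      unfolding r by (rule has_sum_mono[OF lo has_sum_infsum[OF sE]])
        (use mean_xlnx_lower[OF n] in \<open>simp add: T_eq\<close>)
    moreover have "r n \<le> real n * T * A T + real n * exp 1 * Z T"
      unfolding r by (rule has_sum_mono[OF has_sum_infsum[OF sE] up]) (rule le_up)
    ultimately show ?thesis
      using T \<open>n > 0\<close> by (simp add: field_simps power2_eq_square)
  qed
  have A_lim: "((\<lambda>T. A T / T) \<longlongrightarrow> c / 2) at_top"
    using karamata[OF continuous_log_weight] by (simp add: A_def integral_log_weight)
  have Z_lim: "((\<lambda>T. Z T / T) \<longlongrightarrow> c) at_top"
    using lim_at_top[of 1] by (simp add: Z_def)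
  have "((\<lambda>T. A T / T + exp 1 * (Z T / T) * (1 / T)) \<longlongrightarrow> c / 2 + exp 1 * c * 0) at_top"
    by (intro tendsto_intros A_lim Z_lim) real_asymp
  then have up_lim: "((\<lambda>T. A T / T + exp 1 * (Z T / T) * (1 / T)) \<longlongrightarrow> c / 2) at_top" by simp
  have large: "\<forall>\<^sub>F n in sequentially. ln (real n) \<ge> 1"
    using ln_at_top by (simp add: filterlim_at_top)
  have "(\<lambda>n. r n / (real n * (ln (real n))\<^sup>2)) \<longlonglongrightarrow> c / 2"
  proof (rule tendsto_sandwich)
    show "\<forall>\<^sub>F n in sequentially. A (ln (real n)) / ln (real n) \<le> r n / (real n * (ln (real n))\<^sup>2)"
      using large by eventually_elim (use bounds in blast)
    show "\<forall>\<^sub>F n in sequentially. r n / (real n * (ln (real n))\<^sup>2) \<le>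
        A (ln (real n)) / ln (real n) + exp 1 * (Z (ln (real n)) / ln (real n)) * (1 / ln (real n))"
      using large by eventually_elim (use bounds in blast)
  qed (rule filterlim_compose[OF A_lim ln_at_top] filterlim_compose[OF up_lim ln_at_top])+
  then show ?thesis by (simp add: r_def)
qed

end

section \<open>The pole at 1\<close>

text \<open>In each of the three shapes \<open>c\<close> belongs to the pole set, in the P-shape as
  the point with index k = 0, and meromorphy makes the singularity isolated.\<close>

lemma tame_imp_pole:
  assumes "tame F c"
  shows "is_pole F (of_real c)" "isolated_singularity_at F (of_real c)"
proof -
  have "P_pole c t 0 = of_real c" for t by (simp add: P_pole_def complex_eq_iff)
  then have range: "of_real c \<in> range (P_pole c t)" for t by (metis rangeI)
  have "\<exists>D P. meromorphic_with_poles F D P \<and> (P = {of_real c} \<or> (\<exists>t. P = range (P_pole c t)))"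
    using assms unfolding tame_def
  proof (elim conjE disjE)
    assume "S_shape F c"
    then show ?thesis unfolding S_shape_def by blast
  next
    assume "H_shape F c"
    then show ?thesis unfolding H_shape_def by blast
  next
    assume "P_shape F c"
    then show ?thesis unfolding P_shape_def by (elim exE conjE) (intro exI conjI disjI2, assumption, rule refl)
  qed
  then obtain D P where "meromorphic_with_poles F D P"
    and "P = {of_real c} \<or> (\<exists>t. P = range (P_pole c t))" by blast
  moreover from this(2) have "of_real c \<in> P" using range by auto
  ultimately show "is_pole F (of_real c)" "isolated_singularity_at F (of_real c)"
    by (auto simp: meromorphic_with_poles_def meromorphic_on_altdef)
qed

text \<open>Near z, f(w) = g(w) / (w - z) with g holomorphic and g(z) nonzero; g(z) is the
  residue.\<close>

lemma simple_pole_limit_residue: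
  assumes "isolated_singularity_at f z" "is_pole f z" "zorder f z = -1"
  shows "((\<lambda>w. (w - z) * f w) \<longlongrightarrow> residue f z) (at z)" "residue f z \<noteq> 0"
proof -
  obtain e where "e > 0" "f analytic_on ball z e - {z}"
    using assms(1) by (auto simp: isolated_singularity_at_def)
  then have "f holomorphic_on ball z e - {z}" by (simp add: analytic_imp_holomorphic)
  from zorder_exist_pole[OF this open_ball _ assms(2)] \<open>e > 0\<close> assms(3)
  obtain r where g0: "zor_poly f z z \<noteq> 0" and r: "r > 0" "zor_poly f z holomorphic_on cball z r"
    and f: "\<forall>w\<in>cball z r - {z}. f w = zor_poly f z w / (w - z)"
    by auto
  have res: "residue f z = zor_poly f z z" using assms by (rule residue_simple_pole)
  then show "residue f z \<noteq> 0" using g0 by simp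
  have "continuous_on (ball z r) (zor_poly f z)"
    using r by (meson ball_subset_cball continuous_on_subset holomorphic_on_imp_continuous_on)
  then have "isCont (zor_poly f z) z"
    using r by (simp add: continuous_on_eq_continuous_at)
  then have "(zor_poly f z \<longlongrightarrow> residue f z) (at z)" by (simp add: isCont_def res)
  moreover have "\<forall>\<^sub>F w in at z. zor_poly f z w = (w - z) * f w"
    unfolding eventually_at using r f by (intro exI[of _ r]) (auto simp: dist_commute)
  ultimately show "((\<lambda>w. (w - z) * f w) \<longlongrightarrow> residue f z) (at z)"
    by (rule Lim_transform_eventually)
qed

text \<open>
  An infinite sum that does not converge is \<open>0\<close> by convention, so the pole also shows that the series
  converges near \<open>1\<close>, hence on all of \<open>s > 1\<close>.
\<close>

lemma (in iid_source) power_sums_fund_prob: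
  assumes L: "\<And>s. Re s > 1 \<Longrightarrow> L s = source_Lambda M s"
    and lim: "((\<lambda>s. (s - 1) * L s) \<longlongrightarrow> of_real c) (at 1)" and "c \<noteq> 0"
  shows "power_sums (fund_prob M) c"
proof -
  let ?Z = "\<lambda>s. \<Sum>\<^sub>\<infinity>w. fund_prob M w powr s"
  have powr: "complex_of_real (fund_prob M w) powr of_real s = of_real (fund_prob M w powr s)" for w s
    by (simp add: powr_of_real fund_prob_bounds)
  have Lambda: "source_Lambda M (of_real s) = (\<Sum>\<^sub>\<infinity>w. complex_of_real (fund_prob M w powr s))" for s
    by (simp add: source_Lambda_def powr)
  \<comment> \<open>Restrict the complex limit to real s decreasing to 1, where \<open>L\<close> is
    the Dirichlet series.\<close>
  have "filterlim complex_of_real (at (of_real 1)) (at_right 1)"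
    by (intro filterlim_atI tendsto_intros) (auto simp: eventually_at_filter)
  from filterlim_compose[OF lim this[simplified]]
  have "((\<lambda>s. (of_real s - 1) * L (of_real s)) \<longlongrightarrow> of_real c) (at_right 1)" .
  moreover have gt: "\<forall>\<^sub>F s in at_right (1::real). s > 1"
    by (rule eventually_at_right_less)
  ultimately have lim': "((\<lambda>s. of_real (s - 1) * source_Lambda M (of_real s)) \<longlongrightarrow> of_real c) (at_right 1)"
    by (elim Lim_transform_eventually) (auto elim!: eventually_mono simp: L)
  have "\<forall>\<^sub>F s in at_right 1. source_Lambda M (of_real s) \<noteq> 0"
    using tendsto_imp_eventually_ne[OF lim', of 0] \<open>c \<noteq> 0\<close> by (auto elim!: eventually_mono)
  then obtain b where b: "b > 1" "\<And>s. 1 < s \<Longrightarrow> s < b \<Longrightarrow> source_Lambda M (of_real s) \<noteq> 0"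
    by (auto simp: eventually_at_right[of 1 2])
  have summ: "(\<lambda>w. fund_prob M w powr s) summable_on UNIV" if "s > 1" for s
  proof -
    \<comment> \<open>Below \<open>b\<close> the nonzero value forces convergence at
      \<open>t\<close>; below \<open>s\<close>, convergence passes from \<open>t\<close> to
      \<open>s\<close>.\<close>
    obtain t where t: "1 < t" "t < min b s" using b(1) \<open>s > 1\<close> by (intro that[of "(1 + min b s) / 2"]) (auto simp: min_def)
    then have "(\<lambda>w. complex_of_real (fund_prob M w powr t)) summable_on UNIV"
      using b(2)[of t] infsum_not_exists unfolding Lambda by fastforce
    then have "(\<lambda>w. norm (complex_of_real (fund_prob M w powr t))) summable_on UNIV"
      by (simp only: summable_on_iff_abs_summable_on_complex)
    then have "(\<lambda>w. fund_prob M w powr t) summable_on UNIV" by simp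
    then show ?thesis
      by (rule summable_on_powr_mono[rotated 3]) (use t fund_prob_bounds in auto)
  qed
  have "source_Lambda M (of_real s) = of_real (?Z s)" if "s > 1" for s
    unfolding Lambda by (intro infsumI has_sum_of_real has_sum_infsum summ that)
  with gt have "\<forall>\<^sub>F s in at_right 1. of_real (s - 1) * source_Lambda M (of_real s) = complex_of_real ((s - 1) * ?Z s)"
    by (auto elim!: eventually_mono)
  from Lim_transform_eventually[OF lim' this]
  have "((\<lambda>s. (s - 1) * ?Z s) \<longlongrightarrow> c) (at_right 1)"
    by (simp only: tendsto_of_real_iff)
  then show ?thesis
    by unfold_locales (use fund_prob_bounds summ in auto)
qed

text \<open>The function \<open>L\<close> carries the continuation of the Dirichlet series:
  \<open>source_Lambda\<close> takes the default value 0 wherever its sum diverges, so the pole at 1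
  is stated for \<open>L\<close>.\<close>

theorem theorem1:
  fixes M :: "'a::finite stream measure" and h :: real and L :: "complex \<Rightarrow> complex"
  assumes "source M"
    and "has_entropy M h"
    and "\<forall>s. Re s > 1 \<longrightarrow> L s = source_Lambda M s"
    and "tame L 1"
    and "zorder L 1 = -1"
    and "residue L 1 = of_real (1 / h)"
  shows "(\<lambda>n. enn2real (mean_trie_param sorting_toll M n))
           \<sim>[at_top] (\<lambda>n. 1 / (2 * h) * real n * (ln (real n))\<^sup>2)"
proof -
  interpret iid_source M by unfold_locales fact
  have pole: "isolated_singularity_at L 1" "is_pole L 1"
    using tame_imp_pole[OF assms(4)] by auto
  note lim = simple_pole_limit_residue[OF pole assms(5)]
  \<comment> \<open>A simple pole has nonzero residue, which excludes h = 0, where 1 / h would be 0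
    by convention.\<close>
  have "1 / h \<noteq> 0" using lim(2) assms(6) by auto
  then have "h \<noteq> 0" by auto
  have "power_sums (fund_prob M) (1 / h)"
    using lim(1) \<open>1 / h \<noteq> 0\<close> assms(3) by (intro power_sums_fund_prob[of L]) (auto simp: assms(6))
  from tendsto_mult_left[OF mean_trie_param_limit[OF this], of "2 * h"] \<open>h \<noteq> 0\<close>
  have "(\<lambda>n. 2 * h * (enn2real (mean_trie_param sorting_toll M n) / (real n * (ln (real n))\<^sup>2))) \<longlonglongrightarrow> 1"
    by simp
  then have "(\<lambda>n. enn2real (mean_trie_param sorting_toll M n) / (1 / (2 * h) * real n * (ln (real n))\<^sup>2)) \<longlonglongrightarrow> 1"
    by (simp add: field_simps)
  then show ?thesis by (rule asymp_equivI')
qed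

end
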